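(* Let $G$ be a finite simple undirected $2$-connected graph of order $n$ with degree sequence $d_1\le d_2\le\ldots\le d_n$ and minimum degree $\delta=d_1$, where $\delta\le n-2$ (so that the term $d_{\delta+2}$ is defined). Let $c$ be the order of a longest cycle in $G$ and $p$ the order of a longest path in $G$. Then $c\ge\min\{p,\,d_\delta+d_{\delta+2},\,2d_{\delta+1}\}$.
   Context: Graphs are finite and undirected, with neither loops nor multiple edges. The order $n$ of $G$ is its number of vertices. A graph is $2$-connected if its vertex connectivity is at least $2$ (in particular it has at least $3$ vertices). The degree sequence $d_1\le d_2\le\ldots\le d_n$ lists the degrees of all $n$ vertices of $G$ in nondecreasing order, indexed from $1$; its first term $d_1$ is the minimum degree of $G$, denoted $\delta$. Thus $d_\delta$, $d_{\delta+1}$, $d_{\delta+2}$ are the $\delta$-th, $(\delta+1)$-th and $(\delta+2)$-th terms of this sequence. The order of a cycle or path is its number of vertices. *)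

theory Defs
  imports "Graph_Theory.Graph_Theory" "HOL-Library.Multiset"
begin

text \<open>
  A finite simple undirected graph is a \<^locale>\<open>graph\<close>: a finite symmetric digraph
  without loops and parallel arcs, each undirected edge being a pair of opposite arcs.
  Hence the degree of a vertex is its \<^const>\<open>out_degree\<close>.
\<close>

lemma (in graph) out_degree_eq_card_neighbours:
  "out_degree G v = card {u. v \<rightarrow>\<^bsub>G\<^esub> u}"
proof -
  have "inj_on (head G) (out_arcs G v)"
    using no_multi_arcs by (auto simp: inj_on_def out_arcs_def arc_to_ends_def)
  moreover have "head G ` out_arcs G v = {u. v \<rightarrow>\<^bsub>G\<^esub> u}"
    by (force simp: out_arcs_def arcs_ends_conv)
  ultimately show ?thesis
    unfolding out_degree_def by (metis card_image)
qed

definition degree_list :: "('a, 'b) pre_digraph \<Rightarrow> nat list" where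
  "degree_list G = sorted_list_of_multiset (image_mset (out_degree G) (mset_set (verts G)))"

text \<open>The terms \<open>d\<^sub>1 \<le> \<dots> \<le> d\<^sub>n\<close> are indexed from 1; an index outside \<open>{1..n}\<close> is meaningless.\<close>

definition degree_seq :: "('a, 'b) pre_digraph \<Rightarrow> nat \<Rightarrow> nat" where
  "degree_seq G i = degree_list G ! (i - 1)"

text \<open>
  Sets whose deletion leaves at most one vertex are admitted, so that complete graphs get
  connectivity \<open>n - 1\<close>. Since \<^term>\<open>S = verts G\<close> qualifies, the infimum is a minimum.
\<close>

definition vertex_connectivity :: "('a, 'b) pre_digraph \<Rightarrow> nat" where
  "vertex_connectivity G =
    Inf {card S | S. S \<subseteq> verts G \<and>
      (\<not> connected (G \<restriction> (verts G - S)) \<or> card (verts G - S) \<le> 1)}"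

definition two_connected :: "('a, 'b) pre_digraph \<Rightarrow> bool" where
  "two_connected G \<longleftrightarrow> 2 \<le> vertex_connectivity G"

text \<open>
  \<^const>\<open>pre_digraph.cycle\<close> also accepts an arc followed by its reverse, which is not a
  cycle of the undirected graph; this is the only case excluded by the length bound.
  A cycle is a list of arcs, so its length is its number of vertices.
\<close>

definition circumference :: "('a, 'b) pre_digraph \<Rightarrow> nat" where
  "circumference G = Max {length es | es. pre_digraph.cycle G es \<and> 3 \<le> length es}"

text \<open>A \<^const>\<open>vpath\<close> is a list of vertices, so here too the length is the number of vertices.\<close>

definition longest_path_order :: "('a, 'b) pre_digraph \<Rightarrow> nat" where
  "longest_path_order G = Max {length vs | vs. vpath vs G}"

lemma sorted_degree_list: "sorted (degree_list G)"
  by (simp add: degree_list_def)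

lemma (in graph) length_degree_list: "length (degree_list G) = card (verts G)"
  by (simp add: degree_list_def flip: size_mset)

lemma (in graph) degree_seq_1:
  assumes "verts G \<noteq> {}"
  shows "degree_seq G 1 = Min (out_degree G ` verts G)"
proof -
  have set: "set (degree_list G) = out_degree G ` verts G"
    by (simp add: degree_list_def flip: set_mset_mset)
  have ne: "degree_list G \<noteq> []"
    using set assms by auto
  have "Min (set (degree_list G)) = hd (degree_list G)"
    using ne sorted_degree_list[of G] by (cases "degree_list G") (auto intro: Min_eqI)
  then show ?thesis
    using set ne by (simp add: degree_seq_def hd_conv_nth)
qed

lemma two_connected_imp_card_ge_3:
  assumes "two_connected G"
  shows "3 \<le> card (verts G)"
proof (rule ccontr)
  assume "\<not> 3 \<le> card (verts G)"
  then obtain S where S: "S \<subseteq> verts G" "card S \<le> 1" "card (verts G - S) \<le> 1"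
  proof (cases "card (verts G) \<le> 1")
    case True
    then show ?thesis using that[of "{}"] by simp
  next
    case False
    then obtain v where "v \<in> verts G" by fastforce
    then show ?thesis using that[of "{v}"] \<open>\<not> 3 \<le> card (verts G)\<close> by simp
  qed
  have "vertex_connectivity G \<le> card S"
    unfolding vertex_connectivity_def using S by (intro cInf_lower) auto
  with S(2) assms show False by (simp add: two_connected_def)
qed

lemma (in fin_digraph) length_vpath_le:
  assumes "vpath vs G"
  shows "length vs \<le> card (verts G)"
  using assms by (metis card_mono distinct_card finite_verts vpath_def vwalk_def)

lemma (in fin_digraph) length_cycle_le:
  assumes "cycle es"
  shows "length es \<le> card (verts G)"
proof -
  obtain u where u: "awalk u es u" "distinct (tl (awalk_verts u es))"
    using assms by (auto simp: cycle_def)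
  have "awalk_verts u es = u # map (head G) es"
    using u(1) assms by (auto simp: awalk_def awalk_verts_conv' cas_simp cycle_def)
  then have "distinct (map (head G) es)" "set (map (head G) es) \<subseteq> verts G"
    using u by (auto simp: awalk_def)
  then show ?thesis
    by (metis card_mono distinct_card finite_verts length_map)
qed

lemma (in wf_digraph) vwalk_imp_awalk:
  assumes "vwalk vs G"
  shows "\<exists>es. awalk (hd vs) es (last vs) \<and> awalk_verts (hd vs) es = vs"
  using assms
proof (induction vs rule: vwalk_induct)
  case (Base u)
  then show ?case by (intro exI[of _ "[]"]) (simp add: awalk_Nil_iff)
next
  case (Cons u v vs)
  then obtain es where es: "awalk v es (last (v # vs))" "awalk_verts v es = v # vs" by auto
  from Cons(1) obtain e where "e \<in> arcs G" "tail G e = u" "head G e = v"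
    by (auto simp: arcs_ends_conv)
  with es show ?case
    by (intro exI[of _ "e # es"]) (simp add: awalk_Cons_iff)
qed

lemma (in wf_digraph) cycle_iff_closed_vpath:
  assumes "3 \<le> k"
  shows "(\<exists>es. cycle es \<and> length es = k) \<longleftrightarrow>
    (\<exists>vs. vpath vs G \<and> length vs = k \<and> last vs \<rightarrow>\<^bsub>G\<^esub> hd vs)"
proof
  assume "\<exists>es. cycle es \<and> length es = k"
  then obtain u es where es: "awalk u es u" "distinct (tl (awalk_verts u es))" "length es = k"
    by (auto simp: cycle_def)
  have ne: "es \<noteq> []" "tl es \<noteq> []" using es(3) assms by (cases es; force)+
  have tl: "tl (awalk_verts u es) = map (head G) es"
    using es(1) ne by (auto simp: awalk_def awalk_verts_conv')
  have w: "vwalk (awalk_verts u es) G"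
    using es(1) by (rule awalk_imp_vwalk)
  have "awalk_verts u es = u # map (head G) es"
    using es(1) ne by (auto simp: awalk_def awalk_verts_conv' cas_simp)
  with w have "vwalk (map (head G) es) G" "(u, hd (map (head G) es)) \<in> arcs_ends G"
    using ne by (auto elim!: vwalk_consE)
  moreover have "last (map (head G) es) = u"
    using es(1) ne by (metis awalk_ends awalk_def awalk_verts_conv last_map last_snoc awlast_if_cas)
  ultimately show "\<exists>vs. vpath vs G \<and> length vs = k \<and> last vs \<rightarrow>\<^bsub>G\<^esub> hd vs"
    using es tl by (intro exI[of _ "map (head G) es"]) (auto simp: vpath_def)
next
  assume "\<exists>vs. vpath vs G \<and> length vs = k \<and> last vs \<rightarrow>\<^bsub>G\<^esub> hd vs"
  then obtain vs where vs: "vwalk vs G" "distinct vs" "length vs = k" "last vs \<rightarrow>\<^bsub>G\<^esub> hd vs"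
    by (auto simp: vpath_def)
  have "vs \<noteq> []" using vs(1) by (auto simp: vwalk_def)
  then have "vwalk (last vs # vs) G"
    using vs by (intro vwalk_consI) (auto simp: vwalk_def)
  from vwalk_imp_awalk[OF this] obtain es where
    es: "awalk (last vs) es (last vs)" "awalk_verts (last vs) es = last vs # vs"
    using \<open>vs \<noteq> []\<close> by auto
  have len: "length es = k"
    using arg_cong[OF es(2), of length] vs(3) by (simp add: length_awalk_verts)
  show "\<exists>es. cycle es \<and> length es = k"
    using es len vs(2) assms by (intro exI[of _ es]) (auto simp: cycle_def)
qed

end

theory Submission
  imports Defs
begin

text \<open>
  Let \<open>x\<close>, \<open>y\<close> be the ends of a longest path. In a 2-connected graph there is a cycle of order at
  least \<open>min {p, deg x + deg y}\<close>: either neighbours of \<open>x\<close> and \<open>y\<close> cross along the path, and the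
  closest crossing pair gives the cycle, or one climbs along the path, always taking a farthest
  reaching bypass, from the last neighbour of \<open>x\<close> until the first neighbour of \<open>y\<close> is passed.

  Now choose the longest path with \<open>deg x + deg y\<close> maximal and \<open>deg x \<le> deg y\<close>. Rotating the path
  at either end produces \<open>deg x\<close> vertices of degree at most \<open>deg x\<close> (\<open>x\<close> among them, \<open>y\<close> not), and
  likewise for \<open>y\<close>; counting these vertices bounds the terms of the degree sequence.
\<close>

section \<open>Paths and cycles as vertex lists, and deletion of one vertex\<close>

lemma vpath_iff:
  "vpath vs G \<longleftrightarrow> vs \<noteq> [] \<and> set vs \<subseteq> verts G \<and> distinct vs \<and> successively (dominates G) vs"
proof -
  have "set (vwalk_arcs vs) \<subseteq> arcs_ends G \<longleftrightarrow> successively (dominates G) vs"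
    by (induction vs rule: vwalk_arcs.induct) auto
  then show ?thesis by (auto simp: vpath_def vwalk_def)
qed

context graph
begin

lemma dominates_sym: "u \<rightarrow>\<^bsub>G\<^esub> w \<Longrightarrow> w \<rightarrow>\<^bsub>G\<^esub> u"
  using sym_arcs by (rule arcs_ends_symmetric)

lemma dominates_verts: "u \<rightarrow>\<^bsub>G\<^esub> w \<Longrightarrow> u \<in> verts G \<and> w \<in> verts G"
  by (auto simp: arcs_ends_conv)

lemma dominates_irrefl: "\<not> u \<rightarrow>\<^bsub>G\<^esub> u"
  using no_loops by (auto simp: arcs_ends_conv)

text \<open>If deleting \<open>s\<close> disconnected the graph, the set
  \<open>{s} \<inter> verts G\<close>, of size at most 1, would witness a vertex connectivity below
  2. The arcs added by \<open>mk_symmetric\<close> are already in \<open>G\<close> by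
  symmetry.\<close>

lemma two_connected_reach_avoiding:
  assumes "two_connected G" "u \<in> verts G" "w \<in> verts G" "u \<noteq> s" "w \<noteq> s"
  shows "(\<lambda>x y. x \<rightarrow>\<^bsub>G\<^esub> y \<and> y \<noteq> s)\<^sup>*\<^sup>* u w"
proof -
  let ?S = "{s} \<inter> verts G"
  let ?H = "G \<restriction> (verts G - ?S)"
  have "Digraph_Component.connected ?H"
  proof (rule ccontr)
    assume "\<not> Digraph_Component.connected ?H"
    then have "vertex_connectivity G \<le> card ?S"
      unfolding vertex_connectivity_def by (intro cInf_lower) auto
    also have "card ?S \<le> 1" by (metis card_mono finite.emptyI finite.insertI inf_le1 is_singletonI is_singleton_altdef)
    finally show False using assms(1) by (simp add: two_connected_def)
  qed
  then have "u \<rightarrow>\<^sup>*\<^bsub>mk_symmetric ?H\<^esub> w"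
    using assms unfolding Digraph_Component.connected_def strongly_connected_def by auto
  then show ?thesis
    unfolding reachable_def
  proof (induction rule: rtrancl_on_induct)
    case (step x y)
    have "x \<rightarrow>\<^bsub>G\<^esub> y" "y \<noteq> s"
      using step(2) dominates_sym
      by (auto simp: parcs_mk_symmetric in_arcs_imp_in_arcs_ends arcs_ends_conv)
    then show ?case using step by (simp add: rtranclp.rtrancl_into_rtrancl)
  qed simp
qed

text \<open>Unlike \<open>vpath\<close> this admits the empty list, so paths can be cut and glued
  without requiring every piece to be nonempty.\<close>

definition upath :: "'a list \<Rightarrow> bool" where
  "upath vs \<longleftrightarrow> set vs \<subseteq> verts G \<and> distinct vs \<and> successively (dominates G) vs"

lemma upath_append_iff:
  "upath (xs @ ys) \<longleftrightarrow> upath xs \<and> upath ys \<and> set xs \<inter> set ys = {} \<and>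
    (xs = [] \<or> ys = [] \<or> last xs \<rightarrow>\<^bsub>G\<^esub> hd ys)"
  by (auto simp: upath_def successively_append_iff)

lemma upath_rev [simp]: "upath (rev xs) \<longleftrightarrow> upath xs"
proof -
  have "successively (\<lambda>x y. y \<rightarrow>\<^bsub>G\<^esub> x) xs \<longleftrightarrow> successively (dominates G) xs"
    by (rule successively_cong) (auto dest: dominates_sym)
  then show ?thesis by (simp add: upath_def)
qed

text \<open>The bound 3 stands apart from \<open>k\<close>, because for small \<open>k\<close> an
  edge walked back and forth would otherwise pass as a cycle.\<close>

definition cycle_ge :: "nat \<Rightarrow> bool" where
  "cycle_ge k \<longleftrightarrow> (\<exists>vs. upath vs \<and> k \<le> length vs \<and> 3 \<le> length vs \<and> last vs \<rightarrow>\<^bsub>G\<^esub> hd vs)"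

lemma cycle_ge_mono: "cycle_ge k \<Longrightarrow> j \<le> k \<Longrightarrow> cycle_ge j"
  unfolding cycle_ge_def by (meson le_trans)

lemma circumference_ge:
  assumes "cycle_ge k"
  shows "k \<le> circumference G"
proof -
  obtain vs where vs: "upath vs" "k \<le> length vs" "3 \<le> length vs" "last vs \<rightarrow>\<^bsub>G\<^esub> hd vs"
    using assms by (auto simp: cycle_ge_def)
  then have "vpath vs G" by (auto simp: vpath_iff upath_def)
  with vs obtain es where "cycle es" "length es = length vs"
    using cycle_iff_closed_vpath[of "length vs"] by auto
  then have "length vs \<in> {length es | es. cycle es \<and> 3 \<le> length es}"
    using vs(3) by (metis (mono_tags, lifting) mem_Collect_eq)
  moreover have "finite {length es | es. cycle es \<and> 3 \<le> length es}"
    by (rule finite_subset[of _ "{..card (verts G)}"]) (auto simp: length_cycle_le)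
  ultimately have "length vs \<le> circumference G"
    unfolding circumference_def by (rule Max_ge[rotated])
  with vs show ?thesis by simp
qed

end

section \<open>Paths that contain all neighbours of both ends\<close>

text \<open>This is all that the cycle construction uses of a longest path. Indexing the path by
  numbers turns neighbours of the ends into sets of positions, which can be compared and
  shifted.\<close>

locale end_closed_path = graph +
  fixes v :: "nat \<Rightarrow> 'a" and p :: nat
  assumes two_conn: "two_connected G"
    and order_ge_3: "3 \<le> p"
    and inj: "inj_on v {..<p}"
    and in_verts: "i < p \<Longrightarrow> v i \<in> verts G"
    and consecutive: "Suc i < p \<Longrightarrow> v i \<rightarrow>\<^bsub>G\<^esub> v (Suc i)"
    and first_closed: "v 0 \<rightarrow>\<^bsub>G\<^esub> w \<Longrightarrow> w \<in> v ` {..<p}"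
    and last_closed: "v (p - 1) \<rightarrow>\<^bsub>G\<^esub> w \<Longrightarrow> w \<in> v ` {..<p}"
begin

definition seg :: "nat \<Rightarrow> nat \<Rightarrow> 'a list" where
  "seg i j = map v [i..<j]"

lemma set_seg [simp]: "set (seg i j) = v ` {i..<j}"
  by (simp add: seg_def)

lemma length_seg [simp]: "length (seg i j) = j - i"
  by (simp add: seg_def)

lemma seg_eq_Nil [simp]: "seg i j = [] \<longleftrightarrow> j \<le> i"
  by (auto simp: seg_def)

lemma hd_seg [simp]: "i < j \<Longrightarrow> hd (seg i j) = v i"
  by (simp add: seg_def hd_map)

lemma last_seg [simp]: "i < j \<Longrightarrow> last (seg i j) = v (j - 1)"
  by (simp add: seg_def last_map)

lemma upath_seg: "j \<le> p \<Longrightarrow> upath (seg i j)"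
proof (induction j)
  case (Suc j)
  show ?case
  proof (cases "i \<le> j")
    case True
    have "v j \<notin> v ` {i..<j}"
      using inj_onD[OF inj] Suc.prems by fastforce
    moreover have "v (j - 1) \<rightarrow>\<^bsub>G\<^esub> v j" if "i < j"
      using consecutive[of "j - 1"] that Suc.prems by simp
    moreover have "seg i (Suc j) = seg i j @ [v j]"
      using True by (simp add: seg_def)
    ultimately show ?thesis
      using Suc in_verts[of j] by (auto simp: upath_append_iff) (auto simp: upath_def)
  qed (simp add: upath_def seg_def)
qed (simp add: upath_def seg_def)

lemma v_eq_iff: "i < p \<Longrightarrow> j < p \<Longrightarrow> v i = v j \<longleftrightarrow> i = j"
  using inj by (auto dest: inj_onD)

lemma seg_disjoint: "j \<le> k \<Longrightarrow> l \<le> p \<Longrightarrow> set (seg i j) \<inter> set (seg k l) = {}"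
  by (auto simp: v_eq_iff)

definition first_nbrs :: "nat set" where
  "first_nbrs = {i. i < p \<and> v 0 \<rightarrow>\<^bsub>G\<^esub> v i}"

definition last_nbrs :: "nat set" where
  "last_nbrs = {i. i < p \<and> v (p - 1) \<rightarrow>\<^bsub>G\<^esub> v i}"

lemma finite_nbrs [simp]: "finite first_nbrs" "finite last_nbrs"
  by (auto simp: first_nbrs_def last_nbrs_def)

lemma v_first_nbrs: "v ` first_nbrs = {w. v 0 \<rightarrow>\<^bsub>G\<^esub> w}"
  using first_closed by (auto simp: first_nbrs_def)

lemma v_last_nbrs: "v ` last_nbrs = {w. v (p - 1) \<rightarrow>\<^bsub>G\<^esub> w}"
  using last_closed by (auto simp: last_nbrs_def)

lemma card_first_nbrs: "card first_nbrs = out_degree G (v 0)"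
  unfolding out_degree_eq_card_neighbours v_first_nbrs[symmetric]
  by (rule card_image[symmetric]) (rule inj_on_subset[OF inj], auto simp: first_nbrs_def)

lemma card_last_nbrs: "card last_nbrs = out_degree G (v (p - 1))"
  unfolding out_degree_eq_card_neighbours v_last_nbrs[symmetric]
  by (rule card_image[symmetric]) (rule inj_on_subset[OF inj], auto simp: last_nbrs_def)

lemma first_nbrs_facts: "1 \<in> first_nbrs" "0 \<notin> first_nbrs"
  using consecutive[of 0] order_ge_3 dominates_irrefl by (auto simp: first_nbrs_def)

lemma last_nbrs_facts: "p - 2 \<in> last_nbrs" "p - 1 \<notin> last_nbrs"
proof -
  have "Suc (p - 2) = p - 1" using order_ge_3 by simp
  then show "p - 2 \<in> last_nbrs" "p - 1 \<notin> last_nbrs"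
    using consecutive[of "p - 2"] order_ge_3 dominates_irrefl dominates_sym
    by (auto simp: last_nbrs_def)
qed

section \<open>Cycles from crossing neighbours of the ends\<close>

text \<open>For a crossing pair \<open>i < j\<close>, run from \<open>v 0\<close> to
  \<open>v i\<close>, jump to \<open>v (p - 1)\<close>, descend to \<open>v j\<close> and return to
  \<open>v 0\<close>. Only the positions strictly between \<open>i\<close> and \<open>j\<close> are
  lost. If there are none, the cycle has order \<open>p\<close>; otherwise its order is bounded
  below by counting neighbours.\<close>

lemma cycle_if_crossing:
  assumes "i0 \<in> last_nbrs" "j0 \<in> first_nbrs" "i0 < j0"
  shows "cycle_ge (min p (out_degree G (v 0) + out_degree G (v (p - 1))))"
proof -
  \<comment> \<open>No neighbour of either end lies strictly between the indices of a closest crossing pair.\<close>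
  define gap where "gap n \<longleftrightarrow> (\<exists>i j. i \<in> last_nbrs \<and> j \<in> first_nbrs \<and> i < j \<and> n = j - i)" for n
  have "gap (j0 - i0)" using assms by (auto simp: gap_def)
  then have "gap (LEAST n. gap n)" by (rule LeastI)
  then obtain i j where ij: "i \<in> last_nbrs" "j \<in> first_nbrs" "i < j" "j - i = (LEAST n. gap n)"
    by (auto simp: gap_def)
  have min: "j - i \<le> j' - i'" if "i' \<in> last_nbrs" "j' \<in> first_nbrs" "i' < j'" for i' j'
    unfolding ij(4) using that by (intro Least_le) (auto simp: gap_def)
  have jp: "j < p" using ij(2) by (simp add: first_nbrs_def)
  define vs where "vs = seg 0 (Suc i) @ rev (seg j p)"
  have "v (p - 1) \<rightarrow>\<^bsub>G\<^esub> v i" "v 0 \<rightarrow>\<^bsub>G\<^esub> v j"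
    using ij by (auto simp: last_nbrs_def first_nbrs_def)
  moreover have "set (seg 0 (Suc i)) \<inter> set (seg j p) = {}"
    using ij(3) jp by (intro seg_disjoint) auto
  ultimately have "upath vs"
    using ij(3) jp unfolding vs_def upath_append_iff
    by (auto simp: upath_seg hd_rev dest: dominates_sym simp del: set_seg)
  moreover have "last vs \<rightarrow>\<^bsub>G\<^esub> hd vs"
    using \<open>v 0 \<rightarrow>\<^bsub>G\<^esub> v j\<close> jp by (simp add: vs_def last_rev dominates_sym)
  moreover have "length vs = Suc i + (p - j)"
    by (simp add: vs_def)
  \<comment> \<open>A shorter list would force \<open>i = 0\<close> and \<open>j = p - 1\<close>,
    but then \<open>p - 2\<close> and \<open>p - 1\<close> form a closer crossing pair.\<close>
  moreover have "3 \<le> Suc i + (p - j)"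
  proof (rule ccontr)
    assume "\<not> 3 \<le> Suc i + (p - j)"
    then have "i = 0" "j = p - 1" using jp by auto
    moreover have "p - 2 < j" using \<open>j = p - 1\<close> order_ge_3 by simp
    ultimately show False
      using min[OF last_nbrs_facts(1) ij(2)] order_ge_3 by simp
  qed
  moreover have "min p (out_degree G (v 0) + out_degree G (v (p - 1))) \<le> Suc i + (p - j)"
  proof (cases "j = Suc i")
    case True
    then show ?thesis using jp by simp
  next
    case False
    \<comment> \<open>Shifting the neighbours of \<open>v 0\<close> down by one makes them disjoint
      from those of \<open>v (p - 1)\<close>: a common \<open>k\<close> would give the crossing pair
      \<open>k\<close>, \<open>k + 1\<close> of gap 1. Both sets lie in
      \<open>{0..i} \<union> {j - 1..<p - 1}\<close>, whose size is at most the order of the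
      cycle.\<close>
    let ?A = "(\<lambda>k. k - 1) ` first_nbrs"
    have pos: "0 < k" if "k \<in> first_nbrs" for k
      using that first_nbrs_facts(2) by (cases k) auto
    have A: "card ?A = card first_nbrs"
      by (intro card_image inj_onI) (metis One_nat_def Suc_pred pos)
    have A_iff: "k \<in> ?A \<longleftrightarrow> k + 1 \<in> first_nbrs" for k
      using pos by force
    have "k \<in> {0..i} \<union> {j - 1..<p - 1}" if "k \<in> ?A \<union> last_nbrs" for k
    proof -
      have "k \<noteq> p - 1" if "k \<in> last_nbrs" using that last_nbrs_facts(2) by auto
      moreover have "k < p" if "k \<in> last_nbrs" using that by (simp add: last_nbrs_def)
      moreover have "k + 1 < p" if "k + 1 \<in> first_nbrs" using that by (simp add: first_nbrs_def)
      moreover have "k \<le> i \<or> j \<le> k" if "k \<in> last_nbrs"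
        using min[OF that ij(2)] by linarith
      moreover have "k \<le> i \<or> j \<le> k + 1" if "k + 1 \<in> first_nbrs"
        using min[OF ij(1) that] by linarith
      ultimately show ?thesis using \<open>k \<in> ?A \<union> last_nbrs\<close> unfolding Un_iff A_iff by fastforce
    qed
    then have "card (?A \<union> last_nbrs) \<le> card ({0..i} \<union> {j - 1..<p - 1})"
      by (intro card_mono) blast+
    also have "\<dots> \<le> Suc i + (p - j)"
      using card_Un_le[of "{0..i}" "{j - 1..<p - 1}"] ij(3) by simp
    finally have "card (?A \<union> last_nbrs) \<le> Suc i + (p - j)" .
    moreover have "?A \<inter> last_nbrs = {}"
    proof (rule ccontr)
      assume "?A \<inter> last_nbrs \<noteq> {}"
      then obtain k where "k + 1 \<in> first_nbrs" "k \<in> last_nbrs" using A_iff by blast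
      then show False using min[of k "k + 1"] False ij(3) by simp
    qed
    ultimately have "card ?A + card last_nbrs \<le> Suc i + (p - j)"
      by (simp add: card_Un_disjoint)
    then show ?thesis
      unfolding A card_first_nbrs card_last_nbrs by simp
  qed
  ultimately have "upath vs \<and> min p (out_degree G (v 0) + out_degree G (v (p - 1))) \<le> length vs \<and>
    3 \<le> length vs \<and> last vs \<rightarrow>\<^bsub>G\<^esub> hd vs"
    by (simp only:)
  then show ?thesis unfolding cycle_ge_def by blast
qed

section \<open>Bypasses outside the path\<close>

abbreviation off_step :: "'a \<Rightarrow> 'a \<Rightarrow> bool" where
  "off_step x y \<equiv> x \<rightarrow>\<^bsub>G\<^esub> y \<and> y \<notin> v ` {..<p}"

text \<open>Reachability by a walk whose interior avoids the path \<open>v\<close>; the ends may lie on it.\<close>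

definition reach :: "'a \<Rightarrow> 'a \<Rightarrow> bool" where
  "reach u w \<longleftrightarrow> (\<exists>z. off_step\<^sup>*\<^sup>* u z \<and> z \<rightarrow>\<^bsub>G\<^esub> w)"

lemma reach_trans: "off_step\<^sup>*\<^sup>* u z \<Longrightarrow> reach z w \<Longrightarrow> reach u w"
  unfolding reach_def by (meson rtranclp_trans)

text \<open>Induction along the walk: a vertex met again causes \<open>Q\<close> to be cut back to
  its first visit. Each vertex of \<open>Q\<close> is recorded as lying between \<open>u\<close> and
  \<open>z\<close>, so that bounds on what is reachable from \<open>u\<close> pass to it.\<close>

lemma off_path:
  assumes "off_step\<^sup>*\<^sup>* u z"
  shows "\<exists>Q. distinct Q \<and> successively (dominates G) (u # Q) \<and> last (u # Q) = z \<and>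
    set Q \<inter> v ` {..<p} = {} \<and> (\<forall>q\<in>set Q. off_step\<^sup>*\<^sup>* u q \<and> off_step\<^sup>*\<^sup>* q z)"
  using assms
proof (induction rule: rtranclp_induct)
  case base
  then show ?case by (intro exI[of _ "[]"]) simp
next
  case (step z z')
  then obtain Q where Q: "distinct Q" "successively (dominates G) (u # Q)" "last (u # Q) = z"
    "set Q \<inter> v ` {..<p} = {}" "\<And>q. q \<in> set Q \<Longrightarrow> off_step\<^sup>*\<^sup>* u q \<and> off_step\<^sup>*\<^sup>* q z" by blast
  have u: "off_step\<^sup>*\<^sup>* u z'"
    using step(1,2) by (rule rtranclp.rtrancl_into_rtrancl)
  have q: "off_step\<^sup>*\<^sup>* u q \<and> off_step\<^sup>*\<^sup>* q z'" if "q \<in> set Q" for q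
    using Q(5)[OF that] rtranclp.rtrancl_into_rtrancl[of off_step q z z'] step(2) by blast
  show ?case
  proof (cases "z' \<in> set Q")
    case True
    then obtain Q1 Q2 where Qs: "Q = Q1 @ z' # Q2" by (meson split_list)
    have "successively (dominates G) ((u # Q1 @ [z']) @ Q2)"
      using Q(2) by (simp add: Qs)
    then have "successively (dominates G) (u # Q1 @ [z'])"
      by (simp only: successively_append_iff)
    then show ?thesis
      using Q(1,4) q by (intro exI[of _ "Q1 @ [z']"]) (auto simp: Qs)
  next
    case False
    have "successively (dominates G) ((u # Q) @ [z'])"
      unfolding successively_append_iff using Q(2,3) step(2) by simp
    then show ?thesis
      using Q(1,4) q u step(2) False by (intro exI[of _ "Q @ [z']"]) auto
  qed
qed

text \<open>Follow a walk from \<open>v 0\<close> to \<open>v (p - 1)\<close> that avoids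
  \<open>v l\<close>. If nothing led across \<open>l\<close>, every vertex of the walk would be
  reachable by off-path steps from some \<open>v m\<close> with \<open>m < l\<close>. For
  \<open>v (p - 1)\<close> this is absurd, since it lies on the path and differs from
  \<open>v m\<close>.\<close>

lemma reach_across:
  assumes "0 < l" "l < p - 1"
  shows "\<exists>m j. m < l \<and> l < j \<and> j < p \<and> reach (v m) (v j)"
proof (rule ccontr)
  assume none: "\<not> ?thesis"
  have "(\<lambda>x y. x \<rightarrow>\<^bsub>G\<^esub> y \<and> y \<noteq> v l)\<^sup>*\<^sup>* (v 0) (v (p - 1))"
    using assms by (intro two_connected_reach_avoiding two_conn in_verts) (auto simp: v_eq_iff)
  then have "\<exists>m<l. off_step\<^sup>*\<^sup>* (v m) (v (p - 1))"
  proof (induction rule: rtranclp_induct)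
    case base
    then show ?case using assms by blast
  next
    case (step z z')
    then obtain m where m: "m < l" "off_step\<^sup>*\<^sup>* (v m) z" by blast
    show ?case
    proof (cases "z' \<in> v ` {..<p}")
      case True
      then obtain i where i: "z' = v i" "i < p" by blast
      have "reach (v m) (v i)" using m(2) step(2) i by (auto simp: reach_def)
      with none m(1) i have "i \<le> l" by (meson not_le)
      moreover have "i \<noteq> l" using step(2) i by auto
      ultimately show ?thesis unfolding i by (intro exI[of _ i]) simp
    next
      case False
      then have "off_step\<^sup>*\<^sup>* (v m) z'"
        using m(2) step(2) by (intro rtranclp.rtrancl_into_rtrancl[of off_step "v m" z z']) auto
      then show ?thesis using m(1) by blast
    qed
  qed
  then obtain m where m: "m < l" "off_step\<^sup>*\<^sup>* (v m) (v (p - 1))" by blast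
  from m(2) show False
  proof (cases rule: rtranclp.cases)
    case rtrancl_refl
    then show False using m(1) assms by (simp add: v_eq_iff)
  next
    case (rtrancl_into_rtrancl b)
    then show False using order_ge_3 by auto
  qed
qed

definition reach_le :: "'a \<Rightarrow> nat \<Rightarrow> bool" where
  "reach_le u l \<longleftrightarrow> (\<forall>j<p. reach u (v j) \<longrightarrow> j \<le> l)"

text \<open>Let \<open>j\<close> be the largest position reachable from any \<open>v i\<close> with
  \<open>i < l\<close>. Maximality gives \<open>reach_le\<close> for all these vertices. The
  interior \<open>Q\<close> inherits it, because whatever a vertex of \<open>Q\<close> reaches is
  also reached from \<open>v m\<close>.\<close>

lemma farthest_bypass:
  assumes "0 < l" "l < p - 1"
  obtains m j Q where "m < l" "l < j" "j < p" "\<And>i. i < l \<Longrightarrow> reach_le (v i) j"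
    "upath Q" "set Q \<inter> v ` {..<p} = {}" "successively (dominates G) (v m # Q @ [v j])"
    "reach (v m) (v j)" "\<And>q. q \<in> set Q \<Longrightarrow> reach q (v j) \<and> reach_le q j"
proof -
  define J where "J = {j. j < p \<and> (\<exists>m<l. reach (v m) (v j))}"
  have J: "finite J" by (simp add: J_def)
  obtain m0 j0 where j0: "m0 < l" "l < j0" "j0 < p" "reach (v m0) (v j0)"
    using reach_across[OF assms] by blast
  then have "j0 \<in> J" by (auto simp: J_def)
  with J have "Max J \<in> J" "j0 \<le> Max J" by (auto intro: Max_in)
  then obtain m where m: "m < l" "reach (v m) (v (Max J))" and j: "l < Max J" "Max J < p"
    using j0 by (auto simp: J_def)
  have le: "reach_le (v i) (Max J)" if "i < l" for i
    using that J by (auto simp: reach_le_def J_def intro!: Max_ge)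
  from m(2) obtain z where z: "off_step\<^sup>*\<^sup>* (v m) z" "z \<rightarrow>\<^bsub>G\<^esub> v (Max J)"
    by (auto simp: reach_def)
  from off_path[OF z(1)] obtain Q where Q: "distinct Q" "successively (dominates G) (v m # Q)"
    "last (v m # Q) = z" "set Q \<inter> v ` {..<p} = {}"
    "\<And>q. q \<in> set Q \<Longrightarrow> off_step\<^sup>*\<^sup>* (v m) q \<and> off_step\<^sup>*\<^sup>* q z" by blast
  have "q \<in> verts G" if "q \<in> set Q" for q
  proof -
    have "off_step\<^sup>*\<^sup>* (v m) q" "q \<noteq> v m" using Q(4,5) that m(1) assms by auto
    then show ?thesis by (cases rule: rtranclp.cases) (auto dest: dominates_verts)
  qed
  then have "upath Q"
    using Q(1,2) by (auto simp: upath_def successively_Cons)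
  moreover have "successively (dominates G) ((v m # Q) @ [v (Max J)])"
    unfolding successively_append_iff using Q(2,3) z(2) by simp
  moreover have "reach q (v (Max J)) \<and> reach_le q (Max J)" if "q \<in> set Q" for q
  proof
    show "reach q (v (Max J))" using Q(5)[OF that] z(2) unfolding reach_def by blast
    show "reach_le q (Max J)"
      using Q(5)[OF that] le[OF m(1)] reach_trans[of "v m" q] unfolding reach_le_def by blast
  qed
  ultimately show thesis
    using that[of m "Max J" Q] m j le Q(4) by simp
qed

text \<open>The gluing pattern shared by the first cover and its extensions: after \<open>W\<close>,
  climb the path from \<open>v h\<close> to \<open>v m\<close>, then take the bypass
  \<open>Q\<close> to \<open>v j\<close>.\<close>

lemma upath_extend:
  assumes "upath W" "W \<noteq> []" "last W \<rightarrow>\<^bsub>G\<^esub> v h" "h \<le> m" "m < j" "j < p"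
    and "upath Q" "set Q \<inter> v ` {..<p} = {}" "successively (dominates G) (v m # Q @ [v j])"
    and "set W \<inter> v ` {h..m} = {}" "set W \<inter> set Q = {}" "v j \<notin> set W"
  shows "upath (W @ seg h (Suc m) @ Q @ [v j])"
proof -
  have "upath (Q @ [v j])"
    using assms in_verts[of j] by (auto simp: upath_def successively_Cons)
  moreover have "v m \<rightarrow>\<^bsub>G\<^esub> hd (Q @ [v j])"
    using assms(9) by (simp add: successively_Cons)
  moreover have "set (seg h (Suc m)) \<inter> set (Q @ [v j]) = {}"
    using assms(4-6,8) by (auto simp: v_eq_iff)
  moreover have "upath (seg h (Suc m))"
    using assms by (intro upath_seg) simp
  ultimately have "upath (seg h (Suc m) @ (Q @ [v j]))"
    using assms(4) by (simp add: upath_append_iff[of "seg h (Suc m)"])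
  moreover have "set W \<inter> set (seg h (Suc m) @ (Q @ [v j])) = {}"
    using assms(10-12) by (auto simp: atLeastLessThanSuc_atLeastAtMost)
  ultimately show ?thesis
    using assms(1-4) by (simp add: upath_append_iff[of W])
qed

section \<open>Climbing along the path by farthest bypasses\<close>

text \<open>
  The path \<open>v k # T\<close> contains the first vertex and all its neighbours and leaves the vertices of
  index above \<open>k\<close> alone, except for its end \<open>v l\<close>. The last two conditions, provided by choosing
  farthest bypasses, make the next bypass disjoint from \<open>T\<close>.
\<close>

definition cover :: "nat \<Rightarrow> nat \<Rightarrow> 'a list \<Rightarrow> bool" where
  "cover k l T \<longleftrightarrow> k < l \<and> l < p \<and> upath (v k # T) \<and> T \<noteq> [] \<and> last T = v l \<and>
    (\<forall>i<p. k < i \<longrightarrow> v i \<in> set T \<longrightarrow> i = l) \<and>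
    v 0 \<in> set (v k # T) \<and> v ` first_nbrs \<subseteq> set (v k # T) \<and>
    (\<forall>i<k. reach_le (v i) l) \<and> (\<forall>u\<in>set T. u \<notin> v ` {..<p} \<longrightarrow> reach_le u l)"

lemma cover_step:
  assumes "cover k l T" "l < p - 1"
  shows "\<exists>l' T'. l < l' \<and> cover l l' T'"
proof -
  from assms(1) have kl: "k < l" "l < p" and T: "upath (v k # T)" "T \<noteq> []" "last T = v l"
    and only: "\<And>i. i < p \<Longrightarrow> k < i \<Longrightarrow> v i \<in> set T \<Longrightarrow> i = l"
    and nbrs: "v 0 \<in> set (v k # T)" "v ` first_nbrs \<subseteq> set (v k # T)"
    and below: "\<And>i. i < k \<Longrightarrow> reach_le (v i) l"
    and off: "\<And>u. u \<in> set T \<Longrightarrow> u \<notin> v ` {..<p} \<Longrightarrow> reach_le u l"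
    unfolding cover_def by blast+
  obtain m j Q where m: "m < l" and j: "l < j" "j < p" and le: "\<And>i. i < l \<Longrightarrow> reach_le (v i) j"
    and Q: "upath Q" "set Q \<inter> v ` {..<p} = {}" "successively (dominates G) (v m # Q @ [v j])"
    "\<And>q. q \<in> set Q \<Longrightarrow> reach q (v j) \<and> reach_le q j" and mj: "reach (v m) (v j)"
    using farthest_bypass[of l] assms(2) kl(1) by (metis gr_zeroI not_less0)
  \<comment> \<open>From below \<open>k\<close> nothing beyond \<open>l\<close> can be reached, yet
    \<open>v m\<close> reaches \<open>v j\<close> and \<open>l < j\<close>.\<close>
  have km: "k \<le> m"
    using below[of m] mj j by (force simp: reach_le_def)
  define T0 where "T0 = butlast T"
  have T0: "T = T0 @ [v l]" unfolding T0_def using T(2,3) by (metis append_butlast_last_id)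
  \<comment> \<open>From \<open>v l\<close> back along \<open>T\<close> to \<open>v k\<close>, up the path to \<open>v m\<close>, and over the bypass to \<open>v j\<close>.\<close>
  define T' where "T' = rev T0 @ seg k (Suc m) @ Q @ [v j]"
  have sub: "set T \<union> {v k} \<subseteq> set (v l # T')"
    using km by (auto simp: T0 T'_def)
  have "upath (rev T @ seg k (Suc m) @ Q @ [v j])"
  proof (rule upath_extend)
    show "upath (rev T)" using T(1) unfolding upath_rev by (auto simp: upath_def successively_Cons)
    show "last (rev T) \<rightarrow>\<^bsub>G\<^esub> v k"
      using T(1,2) by (auto simp: upath_def successively_Cons last_rev dest: dominates_sym)
    show "set (rev T) \<inter> v ` {k..m} = {}"
    proof -
      have "v i \<notin> set T" if "k \<le> i" "i \<le> m" for i
        using that only[of i] T(1) m kl by (cases "i = k") (auto simp: upath_def)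
      then show ?thesis by auto
    qed
    \<comment> \<open>A common vertex would be an off-path vertex of \<open>T\<close>, hence reach
      at most position \<open>l\<close>, while every vertex of \<open>Q\<close> reaches
      \<open>v j\<close>.\<close>
    show "set (rev T) \<inter> set Q = {}"
    proof -
      have "q \<notin> set T" if "q \<in> set Q" for q
        using that off[of q] Q(2,4) j by (force simp: reach_le_def)
      then show ?thesis by auto
    qed
    show "v j \<notin> set (rev T)" using only[of j] j kl by auto
  qed (use T km m j Q in auto)
  then have "upath (v l # T')" by (simp add: T'_def T0)
  moreover have "last T' = v j" "T' \<noteq> []" by (simp_all add: T'_def)
  moreover have "i = j" if "i < p" "l < i" "v i \<in> set T'" for i
    using that only[of i] kl m j Q(2) by (auto simp: T'_def T0 v_eq_iff)
  moreover have "reach_le u j" if "u \<in> set T'" "u \<notin> v ` {..<p}" for u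
  proof (cases "u \<in> set Q")
    case False
    then have "u \<in> set T" using that m kl j by (auto simp: T'_def T0)
    then show ?thesis using off[of u] that(2) j by (force simp: reach_le_def)
  qed (use Q in blast)
  moreover have "v 0 \<in> set (v l # T')" "v ` first_nbrs \<subseteq> set (v l # T')"
    using nbrs sub by auto
  ultimately have "cover l j T'"
    unfolding cover_def using j le by blast
  with j show ?thesis by blast
qed

text \<open>With \<open>a\<close> the last neighbour of \<open>v 0\<close>, take a farthest bypass
  from some \<open>v m\<close> below \<open>a\<close> to \<open>v j\<close> above it. Let
  \<open>s\<close> be the first neighbour position after \<open>m\<close>. Descend from
  \<open>v a\<close> to \<open>v s\<close>, jump to \<open>v 0\<close>, climb to \<open>v m\<close>
  and cross to \<open>v j\<close>. The skipped positions, strictly between \<open>m\<close> and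
  \<open>s\<close>, hold no neighbour of \<open>v 0\<close>.\<close>

lemma cover_start:
  assumes "Max first_nbrs < p - 1"
  shows "\<exists>l T. cover (Max first_nbrs) l T"
proof -
  define a where "a = Max first_nbrs"
  have a: "a \<in> first_nbrs" "a < p - 1" "\<And>i. i \<in> first_nbrs \<Longrightarrow> i \<le> a"
    unfolding a_def using first_nbrs_facts(1) assms by (auto intro: Max_in)
  then have "0 < a" using first_nbrs_facts(2) by (metis gr0I)
  then obtain m j Q where m: "m < a" and j: "a < j" "j < p" and le: "\<And>i. i < a \<Longrightarrow> reach_le (v i) j"
    and Q: "upath Q" "set Q \<inter> v ` {..<p} = {}" "successively (dominates G) (v m # Q @ [v j])"
    "\<And>q. q \<in> set Q \<Longrightarrow> reach q (v j) \<and> reach_le q j"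
    using farthest_bypass[of a] a(2) by metis
  define s where "s = Min {i \<in> first_nbrs. m < i}"
  have "s \<in> {i \<in> first_nbrs. m < i}"
    unfolding s_def using a(1) m by (intro Min_in) auto
  then have s: "s \<in> first_nbrs" "m < s" "s \<le> a" using a(3) by auto
  have s_min: "s \<le> i" if "i \<in> first_nbrs" "m < i" for i
    unfolding s_def using that by (intro Min_le) auto
  define T where "T = rev (seg s a) @ seg 0 (Suc m) @ Q @ [v j]"
  have rev_seg: "rev (seg s (Suc a)) = v a # rev (seg s a)"
    using s(3) by (simp add: seg_def)
  have s0: "v s \<rightarrow>\<^bsub>G\<^esub> v 0"
    using s(1) by (simp add: first_nbrs_def dominates_sym)
  have "upath (rev (seg s (Suc a)) @ seg 0 (Suc m) @ Q @ [v j])"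
  proof (rule upath_extend)
    show "upath (rev (seg s (Suc a)))" using a(2) by (simp add: upath_seg)
    show "last (rev (seg s (Suc a))) \<rightarrow>\<^bsub>G\<^esub> v 0" using s(3) s0 by (simp add: last_rev)
    show "set (rev (seg s (Suc a))) \<inter> v ` {0..m} = {}"
      using s a(2) by (auto simp: v_eq_iff)
    show "set (rev (seg s (Suc a))) \<inter> set Q = {}"
    proof -
      have "v ` {s..<Suc a} \<subseteq> v ` {..<p}" using a(2) by auto
      then show ?thesis using Q(2) by auto
    qed
    show "v j \<notin> set (rev (seg s (Suc a)))"
      using j by (auto simp: v_eq_iff)
  qed (use Q m j s(3) in auto)
  then have path: "upath (v a # T)" by (simp add: T_def rev_seg)
  have set_T: "set (v a # T) = v ` {s..a} \<union> v ` {..m} \<union> set Q \<union> {v j}"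
  proof -
    have "set (v a # T) = set (rev (seg s (Suc a)) @ seg 0 (Suc m) @ Q @ [v j])"
      by (simp add: T_def rev_seg)
    then show ?thesis by auto
  qed
  have "i = j" if "i < p" "a < i" "v i \<in> set T" for i
  proof -
    have "v i \<in> v ` {s..a} \<union> v ` {..m} \<union> set Q \<union> {v j}"
      using that(3) set_T by auto
    then show ?thesis
      using that(1,2) m s a(2) j Q(2) by (auto simp: v_eq_iff)
  qed
  moreover have "v ` first_nbrs \<subseteq> set (v a # T)"
  proof -
    have "i \<le> m \<or> i \<in> {s..a}" if "i \<in> first_nbrs" for i
      using that s_min a(3) by force
    then show ?thesis unfolding set_T by blast
  qed
  moreover have "v 0 \<in> set (v a # T)" unfolding set_T by blast
  moreover have "reach_le u j" if "u \<in> set T" "u \<notin> v ` {..<p}" for u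
  proof -
    have "u \<in> v ` {s..a} \<union> v ` {..m} \<union> set Q \<union> {v j}"
      using that(1) set_T by auto
    then have "u \<in> set Q" using that(2) m a(2) j by auto
    then show ?thesis using Q by blast
  qed
  moreover have "T \<noteq> []" "last T = v j" by (simp_all add: T_def)
  ultimately have "cover a j T"
    unfolding cover_def using j path le by blast
  then show ?thesis unfolding a_def by blast
qed

text \<open>Iterate \<open>cover_step\<close> until the end position exceeds \<open>b\<close>. Each
  new start is the previous end, so at the first passage it is still at most
  \<open>b\<close>.\<close>

lemma cover_past:
  assumes "cover k l T" "k \<le> b" "b < p - 1"
  shows "\<exists>k l T. cover k l T \<and> k \<le> b \<and> b < l"
  using assms(1,2)
proof (induction "p - l" arbitrary: k l T rule: less_induct)
  case less
  show ?case
  proof (cases "b < l")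
    case False
    then have "l < p - 1" using assms(3) by simp
    then obtain l' T' where l': "l < l'" "cover l l' T'"
      using cover_step less.prems(1) by blast
    have "p - l' < p - l" using l'(1) \<open>l < p - 1\<close> by simp
    then show ?thesis using less.hyps[of l' l T'] l'(2) False by simp
  qed (use less.prems in blast)
qed

text \<open>The cycle takes \<open>v 0\<close> and its neighbours from the cover, and
  \<open>v (p - 1)\<close> and its neighbours from the two path segments added to it. Without
  crossings these two vertex sets share at most one vertex.\<close>

lemma cycle_if_not_crossing:
  assumes ordered: "\<And>i j. i \<in> last_nbrs \<Longrightarrow> j \<in> first_nbrs \<Longrightarrow> j \<le> i"
  shows "cycle_ge (out_degree G (v 0) + out_degree G (v (p - 1)))"
proof -
  define a b where "a = Max first_nbrs" and "b = Min last_nbrs"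
  have a: "a \<in> first_nbrs" "\<And>i. i \<in> first_nbrs \<Longrightarrow> i \<le> a"
    unfolding a_def using first_nbrs_facts(1) by (auto intro: Max_in)
  have b: "b \<in> last_nbrs" "\<And>i. i \<in> last_nbrs \<Longrightarrow> b \<le> i"
    unfolding b_def using last_nbrs_facts(1) by (auto intro: Min_in)
  have "a \<le> b" using ordered a b by blast
  have bp: "b < p - 1"
    using b(1) last_nbrs_facts(2) by (cases "b = p - 1") (auto simp: last_nbrs_def)
  obtain l0 T0 where "cover a l0 T0"
    using cover_start \<open>a \<le> b\<close> bp unfolding a_def by auto
  then obtain k l T where c: "cover k l T" and kbl: "k \<le> b" "b < l"
    using cover_past \<open>a \<le> b\<close> bp by blast
  from c have l: "l < p" and T: "upath (v k # T)" "T \<noteq> []" "last T = v l"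
    and only: "\<And>i. i < p \<Longrightarrow> k < i \<Longrightarrow> v i \<in> set T \<Longrightarrow> i = l"
    and nbrs: "v 0 \<in> set (v k # T)" "v ` first_nbrs \<subseteq> set (v k # T)"
    unfolding cover_def by blast+
  \<comment> \<open>The last neighbour of \<open>v (p - 1)\<close> before \<open>l\<close>; the
    positions strictly between \<open>s\<close> and \<open>l\<close>, which the cycle may miss,
    contain no neighbour of it.\<close>
  define s where "s = Max {i \<in> last_nbrs. i < l}"
  have "s \<in> {i \<in> last_nbrs. i < l}"
    unfolding s_def using b(1) kbl by (intro Max_in) auto
  then have s: "s \<in> last_nbrs" "s < l" "b \<le> s" using b(2) by auto
  have s_max: "i \<le> s" if "i \<in> last_nbrs" "i < l" for i
    unfolding s_def using that by (intro Max_ge) auto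
  define U where "U = butlast T"
  have U: "T = U @ [v l]" unfolding U_def using T(2,3) by (metis append_butlast_last_id)
  have U_disj: "v i \<notin> set U" if "k \<le> i" "i < p" for i
    using that only[of i] T(1) by (cases "i = k") (auto simp: upath_def U)
  \<comment> \<open>Along the cover to \<open>v l\<close>, up the path to \<open>v (p - 1)\<close>,
    across to \<open>v s\<close>, down to \<open>v k\<close>, and back to the head of
    \<open>T\<close>.\<close>
  define vs where "vs = U @ seg l p @ rev (seg k (Suc s))"
  have ks: "k \<le> s" using kbl s by simp
  have "upath (seg l p @ rev (seg k (Suc s)))"
  proof -
    have "set (seg k (Suc s)) \<inter> set (seg l p) = {}"
      using s l by (intro seg_disjoint) auto
    moreover have "v (p - 1) \<rightarrow>\<^bsub>G\<^esub> v s"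
      using s(1) by (simp add: last_nbrs_def)
    ultimately show ?thesis
      unfolding upath_append_iff using s l ks
      by (auto simp: upath_seg hd_rev simp del: set_seg)
  qed
  moreover have "upath U" "U = [] \<or> last U \<rightarrow>\<^bsub>G\<^esub> v l"
    using T(1) unfolding U by (auto simp: upath_def successively_Cons successively_append_iff)
  moreover have "set U \<inter> set (seg l p @ rev (seg k (Suc s))) = {}"
    using U_disj ks s l by auto
  ultimately have "upath vs"
    unfolding vs_def using l by (simp add: upath_append_iff[of U])
  moreover have "last vs \<rightarrow>\<^bsub>G\<^esub> hd vs"
  proof -
    have "hd vs = hd T" using l by (simp add: vs_def U hd_append)
    moreover have "v k \<rightarrow>\<^bsub>G\<^esub> hd T" using T(1,2) by (simp add: upath_def successively_Cons)
    moreover have "last vs = v k" using ks by (simp add: vs_def last_rev)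
    ultimately show ?thesis by simp
  qed
  moreover have len: "out_degree G (v 0) + out_degree G (v (p - 1)) + 1 \<le> length vs"
  proof -
    let ?X = "v ` insert 0 first_nbrs" and ?Y = "v ` insert (p - 1) last_nbrs"
    have "set (v k # T) \<subseteq> set vs"
      using ks l by (auto simp: vs_def U)
    then have X: "?X \<subseteq> set vs" using nbrs by blast
    have "insert (p - 1) last_nbrs \<subseteq> {l..<p} \<union> {k..<Suc s}"
      using s_max l b(2) kbl by (force simp: last_nbrs_def)
    then have Y: "?Y \<subseteq> set vs" by (auto simp: vs_def)
    have lt: "insert 0 first_nbrs \<subseteq> {..<p}" "insert (p - 1) last_nbrs \<subseteq> {..<p}"
      using l by (auto simp: first_nbrs_def last_nbrs_def)
    \<comment> \<open>A common position is at most \<open>a\<close> and at least \<open>b\<close>,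
      where \<open>a \<le> b\<close>. The union thus has at least the degree sum plus 2 minus 1
      elements.\<close>
    have "insert 0 first_nbrs \<inter> insert (p - 1) last_nbrs \<subseteq> {a}"
      using a(2) b(2) \<open>a \<le> b\<close> bp first_nbrs_facts order_ge_3 by fastforce
    then have "card (insert 0 first_nbrs \<inter> insert (p - 1) last_nbrs) \<le> 1"
      using card_mono[of "{a}"] by simp
    moreover have "card (insert 0 first_nbrs) + card (insert (p - 1) last_nbrs) =
      card (insert 0 first_nbrs \<union> insert (p - 1) last_nbrs) +
      card (insert 0 first_nbrs \<inter> insert (p - 1) last_nbrs)"
      by (rule card_Un_Int) simp_all
    moreover have "card (v ` (insert 0 first_nbrs \<union> insert (p - 1) last_nbrs)) =
      card (insert 0 first_nbrs \<union> insert (p - 1) last_nbrs)"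
      using lt by (intro card_image inj_on_subset[OF inj]) blast
    moreover have "card (v ` (insert 0 first_nbrs \<union> insert (p - 1) last_nbrs)) \<le> card (set vs)"
      using X Y by (intro card_mono) auto
    moreover have "card (set vs) \<le> length vs" by (rule card_length)
    ultimately show ?thesis
      using first_nbrs_facts(2) last_nbrs_facts(2)
      by (simp add: card_first_nbrs card_last_nbrs)
  qed
  \<comment> \<open>Together with the extra 1 in \<open>len\<close>, positive end degrees give the
    length 3 that \<open>cycle_ge\<close> demands.\<close>
  moreover have "1 \<le> out_degree G (v 0)" "1 \<le> out_degree G (v (p - 1))"
    unfolding card_first_nbrs[symmetric] card_last_nbrs[symmetric]
    using a(1) b(1) by (auto simp: Suc_le_eq card_gt_0_iff)
  ultimately show ?thesis
    unfolding cycle_ge_def by (intro exI[of _ vs]) auto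
qed

lemma cycle_ge_end_degrees:
  "cycle_ge (min p (out_degree G (v 0) + out_degree G (v (p - 1))))"
proof (cases "\<exists>i j. i \<in> last_nbrs \<and> j \<in> first_nbrs \<and> i < j")
  case False
  then have "cycle_ge (out_degree G (v 0) + out_degree G (v (p - 1)))"
    by (intro cycle_if_not_crossing) (meson not_le)
  then show ?thesis by (rule cycle_ge_mono) simp
qed (use cycle_if_crossing in blast)

end

section \<open>Longest paths and their rotations\<close>

context graph
begin

definition longest_path :: "'a list \<Rightarrow> bool" where
  "longest_path vs \<longleftrightarrow> vpath vs G \<and> (\<forall>ws. vpath ws G \<longrightarrow> length ws \<le> length vs)"

lemma longest_path_iff:
  "longest_path vs \<longleftrightarrow> upath vs \<and> vs \<noteq> [] \<and> (\<forall>ws. upath ws \<longrightarrow> length ws \<le> length vs)"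
proof -
  have "vpath ws G \<longleftrightarrow> upath ws \<and> ws \<noteq> []" for ws
    by (auto simp: vpath_iff upath_def)
  then show ?thesis
    unfolding longest_path_def by (metis le0 list.size(3))
qed

lemma longest_path_rev: "longest_path vs \<Longrightarrow> longest_path (rev vs)"
  by (simp add: longest_path_iff)

lemma longest_path_last_closed:
  assumes "longest_path vs" "last vs \<rightarrow>\<^bsub>G\<^esub> w"
  shows "w \<in> set vs"
proof (rule ccontr)
  assume "w \<notin> set vs"
  then have "upath (vs @ [w])"
    using assms dominates_verts[OF assms(2)]
    by (auto simp: longest_path_iff upath_append_iff) (auto simp: upath_def)
  then show False using assms(1) by (force simp: longest_path_iff)
qed

lemma longest_path_hd_closed:
  assumes "longest_path vs" "hd vs \<rightarrow>\<^bsub>G\<^esub> w"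
  shows "w \<in> set vs"
  using longest_path_last_closed[OF longest_path_rev[OF assms(1)]] assms by (simp add: last_rev)

text \<open>For \<open>t \<noteq> x\<close>, a walk from \<open>x\<close> to a third vertex that
  avoids \<open>t\<close> starts with the required neighbour. If \<open>s = x\<close>, any neighbour
  serves, as there are no loops.\<close>

lemma two_connected_other_neighbour:
  assumes "two_connected G" "x \<in> verts G"
  shows "\<exists>y. x \<rightarrow>\<^bsub>G\<^esub> y \<and> y \<noteq> s"
proof -
  have third: "\<exists>z\<in>verts G. z \<noteq> x \<and> z \<noteq> t" for t
  proof (rule ccontr)
    assume "\<not> ?thesis"
    then have "verts G \<subseteq> {x, t}" by blast
    then have "card (verts G) \<le> card {x, t}" by (intro card_mono) auto
    also have "\<dots> \<le> 2" by (simp add: card_insert_if)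
    finally show False using two_connected_imp_card_ge_3[OF assms(1)] by simp
  qed
  have *: "\<exists>y. x \<rightarrow>\<^bsub>G\<^esub> y \<and> y \<noteq> t" if "t \<noteq> x" for t
  proof -
    obtain z where z: "z \<in> verts G" "z \<noteq> x" "z \<noteq> t" using third by blast
    have "(\<lambda>x y. x \<rightarrow>\<^bsub>G\<^esub> y \<and> y \<noteq> t)\<^sup>*\<^sup>* x z"
      using assms z that by (intro two_connected_reach_avoiding) auto
    then show ?thesis using z(2) by (cases rule: converse_rtranclpE) auto
  qed
  obtain t where "t \<noteq> x" using third by blast
  then show ?thesis
    using *[of s] *[of t] dominates_irrefl by metis
qed

lemma longest_path_order_ge_3:
  assumes "two_connected G" "longest_path vs"
  shows "3 \<le> length vs"
proof -
  obtain x where x: "x \<in> verts G"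
    using two_connected_imp_card_ge_3[OF assms(1)] by fastforce
  then obtain y where y: "x \<rightarrow>\<^bsub>G\<^esub> y" using two_connected_other_neighbour assms(1) by blast
  obtain z where z: "x \<rightarrow>\<^bsub>G\<^esub> z" "z \<noteq> y"
    using two_connected_other_neighbour assms(1) x by blast
  have "upath [y, x, z]"
    using y z dominates_verts dominates_irrefl by (auto simp: upath_def dest: dominates_sym)
  then show ?thesis using assms(2) by (force simp: longest_path_iff)
qed

lemma cycle_ge_longest_path_end_degrees:
  assumes "two_connected G" "longest_path vs"
  shows "cycle_ge (min (length vs) (out_degree G (hd vs) + out_degree G (last vs)))"
proof -
  have vs: "upath vs" "vs \<noteq> []" using assms(2) by (auto simp: longest_path_iff)
  have set: "set vs = (!) vs ` {..<length vs}" by (auto simp: set_conv_nth)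
  interpret end_closed_path G "(!) vs" "length vs"
  proof
    show "inj_on ((!) vs) {..<length vs}"
      using vs(1) by (auto simp: inj_on_def upath_def nth_eq_iff_index_eq)
    show "vs ! i \<in> verts G" if "i < length vs" for i
      using that vs(1) by (auto simp: upath_def)
    show "vs ! i \<rightarrow>\<^bsub>G\<^esub> vs ! Suc i" if "Suc i < length vs" for i
      using that vs(1) by (auto simp: upath_def successively_conv_nth)
    show "w \<in> (!) vs ` {..<length vs}" if "vs ! 0 \<rightarrow>\<^bsub>G\<^esub> w" for w
      using longest_path_hd_closed[OF assms(2)] that vs(2) set by (simp add: hd_conv_nth)
    show "w \<in> (!) vs ` {..<length vs}" if "vs ! (length vs - 1) \<rightarrow>\<^bsub>G\<^esub> w" for w
      using longest_path_last_closed[OF assms(2)] that vs(2) set by (simp add: last_conv_nth)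
  qed (use assms longest_path_order_ge_3 in auto)
  show ?thesis
    using cycle_ge_end_degrees vs(2) by (simp add: hd_conv_nth last_conv_nth)
qed

text \<open>Posa rotation: if the head is adjacent to \<open>vs ! Suc i\<close>, reversing the first
  \<open>Suc i\<close> vertices gives a path on the same vertices with head \<open>vs ! i\<close>
  and the same last vertex. So \<open>A\<close> consists of the path predecessors of the neighbours
  of the head.\<close>

lemma rotations:
  assumes "longest_path vs"
  shows "\<exists>A. A \<subseteq> set vs - {last vs} \<and> card A = out_degree G (hd vs) \<and>
    (\<forall>u\<in>A. \<exists>ws. longest_path ws \<and> hd ws = u \<and> last ws = last vs)"
proof -
  have vs: "upath vs" "vs \<noteq> []" "distinct vs" using assms by (auto simp: longest_path_iff upath_def)
  define I where "I = {i. Suc i < length vs \<and> hd vs \<rightarrow>\<^bsub>G\<^esub> vs ! Suc i}"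
  have "{w. hd vs \<rightarrow>\<^bsub>G\<^esub> w} = (\<lambda>i. vs ! Suc i) ` I"
  proof (intro equalityI subsetI)
    fix w assume "w \<in> {w. hd vs \<rightarrow>\<^bsub>G\<^esub> w}"
    then have w: "hd vs \<rightarrow>\<^bsub>G\<^esub> w" by simp
    then obtain i where i: "i < length vs" "w = vs ! i"
      using longest_path_hd_closed[OF assms] by (metis in_set_conv_nth)
    have "i \<noteq> 0" using w i vs(2) dominates_irrefl by (metis hd_conv_nth)
    then show "w \<in> (\<lambda>i. vs ! Suc i) ` I"
      using i w by (cases i) (auto simp: I_def)
  qed (auto simp: I_def)
  moreover have "inj_on (\<lambda>i. vs ! Suc i) I" "inj_on ((!) vs) I"
    using vs(3) by (auto simp: inj_on_def I_def nth_eq_iff_index_eq)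
  ultimately have "card ((!) vs ` I) = out_degree G (hd vs)"
    by (simp add: out_degree_eq_card_neighbours card_image)
  moreover have "(!) vs ` I \<subseteq> set vs - {last vs}"
    using vs(2,3) by (auto simp: I_def last_conv_nth nth_eq_iff_index_eq)
  moreover have "\<exists>ws. longest_path ws \<and> hd ws = vs ! i \<and> last ws = last vs" if "i \<in> I" for i
  proof -
    define ws where "ws = rev (take (Suc i) vs) @ drop (Suc i) vs"
    have i: "Suc i < length vs" "hd vs \<rightarrow>\<^bsub>G\<^esub> vs ! Suc i" using that by (auto simp: I_def)
    have "upath (take (Suc i) vs @ drop (Suc i) vs)" using vs(1) by simp
    then have "upath ws"
      unfolding ws_def upath_append_iff using i vs(2)
      by (auto simp: last_rev hd_drop_conv_nth)
    moreover have "hd ws = vs ! i" "last ws = last vs" "length ws = length vs"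
      using i by (auto simp: ws_def take_Suc_conv_app_nth)
    ultimately show ?thesis
      using assms vs(2) by (intro exI[of _ ws]) (auto simp: longest_path_iff)
  qed
  ultimately show ?thesis by (intro exI[of _ "(!) vs ` I"]) auto
qed

section \<open>From rotations to the degree sequence\<close>

text \<open>If the \<open>k\<close>-th term exceeded \<open>m\<close>, sortedness would leave at
  most \<open>k - 1\<close> entries bounded by \<open>m\<close>, fewer than \<open>S\<close>
  supplies. For \<open>k = 0\<close> truncated subtraction reads the first term, so \<open>S\<close>
  must be nonempty.\<close>

lemma degree_seq_le:
  assumes "S \<subseteq> verts G" "k \<le> card S" "0 < card S" "\<And>u. u \<in> S \<Longrightarrow> out_degree G u \<le> m"
  shows "degree_seq G k \<le> m"
proof (rule ccontr)
  assume "\<not> degree_seq G k \<le> m"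
  then have big: "m < degree_list G ! (k - 1)" by (simp add: degree_seq_def)
  have "card S \<le> card {u \<in> verts G. out_degree G u \<le> m}"
    using assms by (intro card_mono) auto
  also have "\<dots> = size (filter_mset (\<lambda>x. x \<le> m) (image_mset (out_degree G) (mset_set (verts G))))"
    by (simp add: filter_mset_image_mset)
  also have "\<dots> = length (filter (\<lambda>x. x \<le> m) (degree_list G))"
    by (simp only: degree_list_def size_mset[symmetric] mset_filter mset_sorted_list_of_multiset)
  also have "\<dots> = card {i. i < length (degree_list G) \<and> degree_list G ! i \<le> m}"
    by (rule length_filter_conv_card)
  also have "\<dots> \<le> card {..<k - 1}"
  proof (rule card_mono)
    have "i < k - 1" if "i < length (degree_list G)" "degree_list G ! i \<le> m" for i
      using that big sorted_nth_mono[OF sorted_degree_list, of "k - 1" i G]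
      by (meson leD le_trans not_le)
    then show "{i. i < length (degree_list G) \<and> degree_list G ! i \<le> m} \<subseteq> {..<k - 1}" by auto
  qed simp
  finally show False using assms(2,3) by simp
qed

lemma degree_seq_1_le: "u \<in> verts G \<Longrightarrow> degree_seq G 1 \<le> out_degree G u"
  by (subst degree_seq_1) auto

lemma end_degrees_bound:
  assumes "longest_path vs"
    and maximal: "\<And>ws. longest_path ws \<Longrightarrow>
      out_degree G (hd ws) + out_degree G (last ws) \<le> out_degree G (hd vs) + out_degree G (last vs)"
    and le: "out_degree G (hd vs) \<le> out_degree G (last vs)"
    and pos: "0 < out_degree G (hd vs)"
    and \<delta>: "\<delta> = degree_seq G 1"
  shows "min (degree_seq G \<delta> + degree_seq G (\<delta> + 2)) (2 * degree_seq G (\<delta> + 1))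
    \<le> out_degree G (hd vs) + out_degree G (last vs)"
proof -
  let ?x = "out_degree G (hd vs)" and ?y = "out_degree G (last vs)"
  have vs: "vs \<noteq> []" "set vs \<subseteq> verts G" using assms(1) by (auto simp: longest_path_iff upath_def)
  obtain A where A: "A \<subseteq> set vs - {last vs}" "card A = ?x"
    "\<And>u. u \<in> A \<Longrightarrow> \<exists>ws. longest_path ws \<and> hd ws = u \<and> last ws = last vs"
    using rotations[OF assms(1)] by blast
  obtain B where B: "B \<subseteq> set vs - {hd vs}" "card B = ?y"
    "\<And>u. u \<in> B \<Longrightarrow> \<exists>ws. longest_path ws \<and> hd ws = u \<and> last ws = hd vs"
    using rotations[OF longest_path_rev[OF assms(1)]] vs(1) by (auto simp: hd_rev last_rev)
  \<comment> \<open>A rotation keeps the other end, so a larger degree at the new end would increase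
    the maximal degree sum.\<close>
  have A_le: "out_degree G u \<le> ?x" if "u \<in> A" for u
    using A(3)[OF that] maximal by fastforce
  have B_le: "out_degree G u \<le> ?y" if "u \<in> B" for u
    using B(3)[OF that] maximal by fastforce
  have hd: "hd vs \<in> verts G" using vs by auto
  have AV: "A \<subseteq> verts G" using A(1) vs(2) by blast
  \<comment> \<open>Since \<open>?x \<le> ?y\<close>, the head can join \<open>B\<close>: this makes
    \<open>?y + 1\<close> vertices of degree at most \<open>?y\<close>, enough to reach the index
    one higher.\<close>
  have "B \<subseteq> set vs" "hd vs \<notin> B" using B(1) by auto
  then have BV: "insert (hd vs) B \<subseteq> verts G" and cardB: "card (insert (hd vs) B) = ?y + 1"
    using hd vs(2) B(2) finite_subset[of B "set vs"] by auto
  have hdB_le: "out_degree G u \<le> ?y" if "u \<in> insert (hd vs) B" for u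
    using that B_le le by auto
  have "\<delta> \<le> ?x" unfolding \<delta> by (rule degree_seq_1_le[OF hd])
  \<comment> \<open>In the first and third cases the term at \<open>\<delta> + 1\<close> is at most
    both end degrees. In the second, \<open>A\<close> bounds the term at \<open>\<delta>\<close> and
    the enlarged \<open>B\<close> the term at \<open>\<delta> + 2\<close>.\<close>
  then consider "\<delta> + 1 \<le> ?x" | "?x = \<delta>" "\<delta> + 1 \<le> ?y" | "?x = \<delta>" "?y = \<delta>"
    using le by linarith
  then show ?thesis
  proof cases
    case 1
    then have "degree_seq G (\<delta> + 1) \<le> ?x"
      using AV A(2) A_le by (intro degree_seq_le[of A]) auto
    then show ?thesis using le by simp
  next
    case 2
    have "degree_seq G \<delta> \<le> ?x"
      using AV A(2) A_le 2 pos by (intro degree_seq_le[of A]) auto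
    moreover have "degree_seq G (\<delta> + 2) \<le> ?y"
      using BV cardB hdB_le 2 by (intro degree_seq_le[of "insert (hd vs) B"]) auto
    ultimately show ?thesis by simp
  next
    case 3
    have "degree_seq G (\<delta> + 1) \<le> ?y"
      using BV cardB hdB_le 3 by (intro degree_seq_le[of "insert (hd vs) B"]) auto
    then show ?thesis using 3 by simp
  qed
qed

lemma finite_vpaths: "finite {vs. vpath vs G}"
proof (rule finite_subset)
  show "{vs. vpath vs G} \<subseteq> {vs. set vs \<subseteq> verts G \<and> length vs \<le> card (verts G)}"
    using length_vpath_le by (auto simp: vpath_iff)
qed (simp add: finite_lists_length_le)

lemma circumference_bound:
  assumes two: "two_connected G" and \<delta>: "\<delta> = degree_seq G 1"
  shows "min (longest_path_order G)
    (min (degree_seq G \<delta> + degree_seq G (\<delta> + 2)) (2 * degree_seq G (\<delta> + 1))) \<le> circumference G"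
proof -
  let ?L = "{vs. longest_path vs}"
  let ?f = "\<lambda>vs. out_degree G (hd vs) + out_degree G (last vs)"
  have lengths: "{length vs | vs. vpath vs G} = length ` {vs. vpath vs G}" by blast
  obtain x where "x \<in> verts G"
    using two_connected_imp_card_ge_3[OF two] by fastforce
  then have "vpath [x] G" by (simp add: vpath_iff)
  then have "longest_path_order G \<in> length ` {vs. vpath vs G}"
    unfolding longest_path_order_def lengths using finite_vpaths by (intro Max_in) auto
  moreover have le_order: "length ws \<le> longest_path_order G" if "vpath ws G" for ws
    unfolding longest_path_order_def lengths using finite_vpaths that by (intro Max_ge) auto
  ultimately have "?L \<noteq> {}" by (auto simp: longest_path_def)
  moreover have "finite ?L"
    using finite_vpaths by (rule rev_finite_subset) (auto simp: longest_path_def)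
  ultimately have fin: "finite (?f ` ?L)" and "Max (?f ` ?L) \<in> ?f ` ?L"
    by (blast, intro Max_in) auto
  then obtain us where us: "longest_path us" "Max (?f ` ?L) = ?f us" by blast
  have us_max: "?f ws \<le> ?f us" if "longest_path ws" for ws
    unfolding us(2)[symmetric] using fin that by (intro Max_ge) auto
  \<comment> \<open>Reversal keeps the degree sum, so the end of smaller degree may be put
    first.\<close>
  define vs where "vs = (if out_degree G (hd us) \<le> out_degree G (last us) then us else rev us)"
  have "us \<noteq> []" using us(1) by (simp add: longest_path_iff)
  then have f: "?f vs = ?f us" and le: "out_degree G (hd vs) \<le> out_degree G (last vs)"
    by (auto simp: vs_def hd_rev last_rev)
  have vs: "longest_path vs" using us(1) longest_path_rev by (simp add: vs_def)
  have len: "length vs = longest_path_order G"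
    unfolding longest_path_order_def lengths
    using vs finite_vpaths by (intro Max_eqI[symmetric]) (auto simp: longest_path_def)
  have "hd vs \<in> verts G" using vs by (auto simp: longest_path_iff upath_def)
  then obtain y where "hd vs \<rightarrow>\<^bsub>G\<^esub> y"
    using two_connected_other_neighbour[OF two] by blast
  then have "0 < out_degree G (hd vs)"
    unfolding out_degree_eq_card_neighbours card_gt_0_iff
    by (auto intro: finite_subset[of _ "verts G"] dest: dominates_verts)
  then have "min (degree_seq G \<delta> + degree_seq G (\<delta> + 2)) (2 * degree_seq G (\<delta> + 1)) \<le> ?f vs"
    using vs us_max f le \<delta> by (intro end_degrees_bound) auto
  moreover have "min (longest_path_order G) (?f vs) \<le> circumference G"
    using cycle_ge_longest_path_end_degrees[OF two vs] len by (auto intro: circumference_ge)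
  ultimately show ?thesis by linarith
qed

end

theorem theorem4:
  fixes G :: "('a, 'b) pre_digraph"
    and n \<delta> c p :: nat
    and d :: "nat \<Rightarrow> nat"
  assumes "graph G"
    and "two_connected G"
    and "n = card (verts G)"
    and "d = degree_seq G"
    and "\<delta> = d 1"
    and "\<delta> \<le> n - 2"
    and "c = circumference G"
    and "p = longest_path_order G"
  shows "c \<ge> Min {p, d \<delta> + d (\<delta> + 2), 2 * d (\<delta> + 1)}"
  using graph.circumference_bound[OF assms(1,2), of \<delta>] assms(4,5,7,8) by simp

end
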